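(* Let $P$ be a poset that is UCTP with top chain. Then every induced $P$-saturating family $\mathcal F\subseteq 2^{[n]}$ is separating; consequently $\mathrm{sat}^*(n,P)\ge\log_2 n$ for all $n\ge1$.
   Context: In a poset, $y$ covers $x$ if $x<y$ and there is no $z$ with $x<z<y$. A poset has the unique cover twin property (UCTP) if whenever $y$ covers $x$, there is an element $z$ that is comparable to one of $x,y$ and incomparable to the other. A poset $P$ is UCTP with top chain if $P$ is the union of a poset $P_0$ with $|P_0|\ge 2$ that has UCTP and a chain $C$ such that every element of $P_0$ is smaller than every element of $C$. A subfamily $\mathcal G\subseteq\mathcal F\subseteq 2^{[n]}$ is an induced copy of $P$ if there is a bijection $i:P\to\mathcal G$ with $p\le_P q$ iff $i(p)\subseteq i(q)$; $\mathcal F$ is induced $P$-saturating if it has no induced copy of $P$ and adding any $G\in2^{[n]}\setminus\mathcal F$ creates one. $\mathcal F$ is separating if for any two distinct $x,y\in[n]$ some $F\in\mathcal F$ has $|F\cap\{x,y\}|=1$. $\mathrm{sat}^*(n,P)$ is the minimum size of an induced $P$-saturating family in $2^{[n]}$. *)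

theory Defs
  imports Complex_Main
begin

text \<open>
  A poset is a set \<open>P\<close> of elements of an arbitrary type of class \<open>order\<close>, with the order
  inherited from the type. No finiteness of \<open>P\<close> is assumed. Covering is relative to \<open>P\<close>.
\<close>

definition covers_in :: "'a::order set \<Rightarrow> 'a \<Rightarrow> 'a \<Rightarrow> bool" where
  "covers_in P y x \<longleftrightarrow> x \<in> P \<and> y \<in> P \<and> x < y \<and> \<not> (\<exists>z\<in>P. x < z \<and> z < y)"

definition comparable :: "'a::order \<Rightarrow> 'a \<Rightarrow> bool" where
  "comparable x y \<longleftrightarrow> x \<le> y \<or> y \<le> x"

definition uctp :: "'a::order set \<Rightarrow> bool" where
  "uctp P \<longleftrightarrow>
     (\<forall>x y. covers_in P y x \<longrightarrow>
        (\<exists>z\<in>P. (comparable z x \<and> \<not> comparable z y) \<or> (comparable z y \<and> \<not> comparable z x)))"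

text \<open>
  The condition that \<open>P0\<close> has at least two elements is not written with \<^const>\<open>card\<close>, which is
  \<open>0\<close> on infinite sets. The chain \<open>C\<close> may be empty.
\<close>

definition uctp_with_top_chain :: "'a::order set \<Rightarrow> bool" where
  "uctp_with_top_chain P \<longleftrightarrow>
     (\<exists>P0 C. P = P0 \<union> C \<and> (\<exists>a\<in>P0. \<exists>b\<in>P0. a \<noteq> b) \<and> uctp P0 \<and>
        Complete_Partial_Order.chain (\<le>) C \<and> (\<forall>p\<in>P0. \<forall>c\<in>C. p < c))"

definition induced_copy :: "'a::order set \<Rightarrow> nat set set \<Rightarrow> bool" where
  "induced_copy P \<G> \<longleftrightarrow>
     (\<exists>i. bij_betw i P \<G> \<and> (\<forall>p\<in>P. \<forall>q\<in>P. p \<le> q \<longleftrightarrow> i p \<subseteq> i q))"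

definition contains_induced_copy :: "nat set set \<Rightarrow> 'a::order set \<Rightarrow> bool" where
  "contains_induced_copy \<F> P \<longleftrightarrow> (\<exists>\<G>\<subseteq>\<F>. induced_copy P \<G>)"

definition induced_saturating :: "nat \<Rightarrow> 'a::order set \<Rightarrow> nat set set \<Rightarrow> bool" where
  "induced_saturating n P \<F> \<longleftrightarrow>
     \<F> \<subseteq> Pow {1..n} \<and> \<not> contains_induced_copy \<F> P \<and>
     (\<forall>G \<in> Pow {1..n} - \<F>. contains_induced_copy (insert G \<F>) P)"

definition separating :: "nat \<Rightarrow> nat set set \<Rightarrow> bool" where
  "separating n \<F> \<longleftrightarrow>
     (\<forall>x\<in>{1..n}. \<forall>y\<in>{1..n}. x \<noteq> y \<longrightarrow> (\<exists>F\<in>\<F>. card (F \<inter> {x, y}) = 1))"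

text \<open>
  For nonempty \<open>P\<close> a saturating family exists (take a maximal subfamily of \<open>Pow {1..n}\<close>
  without an induced copy), so the minimum below is attained.
\<close>

definition sat_star :: "nat \<Rightarrow> 'a::order set \<Rightarrow> nat" where
  "sat_star n P = (LEAST m. \<exists>\<F>. induced_saturating n P \<F> \<and> card \<F> = m)"

end

theory Submission
  imports Defs
begin

text \<open>
  Write \<open>P = P\<^sub>1 \<union> T\<close>, where \<open>T\<close> is a chain above \<open>P\<^sub>1\<close>, \<open>P\<^sub>1\<close> is nonempty without greatest
  element, and every cover in \<open>P\<close> whose lower element lies in \<open>P\<^sub>1\<close> has a twin witness: a greatest
  element of \<open>P\<^sub>0\<close>, if there is one, is moved into \<open>T\<close>.

  Suppose that no member of the saturating family \<open>\<F>\<close> separates \<open>x\<close> and \<open>y\<close>, and call a set high if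
  \<open>\<F>\<close> contains a copy of \<open>P\<^sub>1\<close> strictly below it. If \<open>G \<notin> \<F>\<close> is not high, then \<open>G\<close> plays the role of
  an element of \<open>P\<^sub>1\<close> in the copy of \<open>P\<close> that it creates, and no set in a role of \<open>P\<^sub>1\<close> is high there:
  otherwise the copy of \<open>P\<^sub>1\<close> below it together with the sets in the roles of \<open>T\<close> would be a copy
  of \<open>P\<close> in \<open>\<F>\<close>.

  If some member of \<open>\<F>\<close> avoids \<open>x\<close>, take a maximal such \<open>A\<close> for which \<open>A \<union> {x}\<close> is not high, and
  let \<open>G = A \<union> {x}\<close>. Otherwise take a minimal \<open>A \<in> \<F>\<close> and let \<open>G = A - {x}\<close>. In both cases \<open>A\<close> and
  \<open>G\<close> are comparable to the same sets of the copy created by \<open>G\<close>. If \<open>A\<close> is not in the copy, it can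
  replace \<open>G\<close>, which gives a copy in \<open>\<F>\<close>; if it is, the roles of \<open>A\<close> and \<open>G\<close> form a cover without a
  twin witness.
\<close>

section \<open>Induced copies as order embeddings\<close>

text \<open>Injectivity follows by antisymmetry, so such an \<open>i\<close> is the same thing as an
  induced copy contained in \<open>\<F>\<close>.\<close>

definition embeds :: "('a::order \<Rightarrow> nat set) \<Rightarrow> 'a set \<Rightarrow> nat set set \<Rightarrow> bool" where
  "embeds i P \<F> \<longleftrightarrow> i ` P \<subseteq> \<F> \<and> (\<forall>p\<in>P. \<forall>q\<in>P. p \<le> q \<longleftrightarrow> i p \<subseteq> i q)"

lemma embeds_in: "embeds i P \<F> \<Longrightarrow> p \<in> P \<Longrightarrow> i p \<in> \<F>"
  by (auto simp: embeds_def)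

lemma embeds_le_iff: "embeds i P \<F> \<Longrightarrow> p \<in> P \<Longrightarrow> q \<in> P \<Longrightarrow> i p \<subseteq> i q \<longleftrightarrow> p \<le> q"
  by (auto simp: embeds_def)

lemma embeds_eq_iff: "embeds i P \<F> \<Longrightarrow> p \<in> P \<Longrightarrow> q \<in> P \<Longrightarrow> i p = i q \<longleftrightarrow> p = q"
  using embeds_le_iff by (metis order_antisym order_refl)

lemma embeds_less_iff: "embeds i P \<F> \<Longrightarrow> p \<in> P \<Longrightarrow> q \<in> P \<Longrightarrow> i p \<subset> i q \<longleftrightarrow> p < q"
  by (simp add: psubset_eq order_less_le embeds_eq_iff embeds_le_iff)

lemma contains_induced_copy_iff: "contains_induced_copy \<F> P \<longleftrightarrow> (\<exists>i. embeds i P \<F>)"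
proof
  assume "contains_induced_copy \<F> P"
  then obtain \<G> i where "\<G> \<subseteq> \<F>" "bij_betw i P \<G>" "\<forall>p\<in>P. \<forall>q\<in>P. p \<le> q \<longleftrightarrow> i p \<subseteq> i q"
    unfolding contains_induced_copy_def induced_copy_def by auto
  then have "embeds i P \<F>"
    unfolding embeds_def by (simp add: bij_betw_def)
  then show "\<exists>i. embeds i P \<F>" by blast
next
  assume "\<exists>i. embeds i P \<F>"
  then obtain i where i: "embeds i P \<F>" by blast
  then have "inj_on i P"
    by (auto intro: inj_onI simp: embeds_eq_iff)
  then have "bij_betw i P (i ` P)"
    by (rule inj_on_imp_bij_betw)
  moreover have "\<forall>p\<in>P. \<forall>q\<in>P. p \<le> q \<longleftrightarrow> i p \<subseteq> i q" "i ` P \<subseteq> \<F>"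
    using i by (simp_all add: embeds_def)
  ultimately show "contains_induced_copy \<F> P"
    unfolding contains_induced_copy_def induced_copy_def by meson
qed

lemma embeds_uses_new:
  assumes "embeds i P (insert G \<F>)" "\<not> contains_induced_copy \<F> P"
  obtains p where "p \<in> P" "i p = G"
proof -
  have "\<not> embeds i P \<F>" using assms(2) contains_induced_copy_iff by blast
  with assms(1) have "\<not> i ` P \<subseteq> \<F>" "i ` P \<subseteq> insert G \<F>" by (simp_all add: embeds_def)
  then show thesis using that by blast
qed

section \<open>Exchanging the added set for a member\<close>

text \<open>The equivalences exempt the sets \<open>G\<close> and \<open>A\<close>: these are
  strictly comparable, so at each of them one equivalence fails.\<close>

lemma no_copy_imp_cover_without_twin:
  assumes no: "\<not> contains_induced_copy \<F> P"
    and i: "embeds i P (insert G \<F>)" and p: "p \<in> P" "i p = G"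
    and A: "A \<in> \<F>" and AG: "A \<subset> G \<or> G \<subset> A"
    and below: "\<And>r. r \<in> P \<Longrightarrow> i r \<noteq> G \<Longrightarrow> i r \<noteq> A \<Longrightarrow> i r \<subseteq> A \<longleftrightarrow> i r \<subseteq> G"
    and above: "\<And>r. r \<in> P \<Longrightarrow> i r \<noteq> G \<Longrightarrow> i r \<noteq> A \<Longrightarrow> A \<subseteq> i r \<longleftrightarrow> G \<subseteq> i r"
  obtains q where "covers_in P p q \<or> covers_in P q p"
    "\<And>z. z \<in> P \<Longrightarrow> comparable z p \<longleftrightarrow> comparable z q"
proof -
  have "\<exists>q\<in>P. i q = A"
  proof (rule ccontr)
    assume notA: "\<not> ?thesis"
    have other: "i r \<noteq> G" "i r \<noteq> A" "i r \<in> \<F>" if "r \<in> P" "r \<noteq> p" for r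
      using that notA p embeds_eq_iff[OF i] embeds_in[OF i] by blast+
    have le: "r \<le> s \<longleftrightarrow> (i(p := A)) r \<subseteq> (i(p := A)) s" if "r \<in> P" "s \<in> P" for r s
      using that p other[of r] other[of s] below[of r] above[of s]
        embeds_le_iff[OF i, of r s, symmetric]
      by (cases "r = p"; cases "s = p") simp_all
    have "embeds (i(p := A)) P \<F>"
      unfolding embeds_def using le other A by auto
    then show False using no contains_induced_copy_iff by blast
  qed
  then obtain q where q: "q \<in> P" "i q = A" by blast
  have pq: "p < q \<or> q < p"
    using AG p q embeds_less_iff[OF i] by blast
  have same: "z \<le> q \<longleftrightarrow> z \<le> p" "q \<le> z \<longleftrightarrow> p \<le> z" if "z \<in> P" "z \<noteq> p" "z \<noteq> q" for z
    using that p q below[of z] above[of z] embeds_eq_iff[OF i] embeds_le_iff[OF i] by metis+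
  show thesis
  proof (rule that)
    \<comment> \<open>An element strictly between \<open>p\<close> and \<open>q\<close> would, by
      \<open>same\<close>, lie on the same side of both.\<close>
    show "covers_in P p q \<or> covers_in P q p"
      using pq same p q unfolding covers_in_def by (metis order_less_le order_less_not_sym)
    show "comparable z p \<longleftrightarrow> comparable z q" if "z \<in> P" for z
      using pq same[OF that] unfolding comparable_def by (cases "z = p \<or> z = q") auto
  qed
qed

section \<open>High sets\<close>

text \<open>With \<open>P\<^sub>1\<close> for \<open>P\<close>, this says that \<open>A\<close> is high.\<close>

definition copy_below :: "'a::order set \<Rightarrow> nat set set \<Rightarrow> nat set \<Rightarrow> bool" where
  "copy_below P \<F> A \<longleftrightarrow> (\<exists>j. embeds j P \<F> \<and> (\<forall>p\<in>P. j p \<subset> A))"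

lemma not_copy_below_low_role:
  assumes no: "\<not> contains_induced_copy \<F> (P1 \<union> T)"
    and i: "embeds i (P1 \<union> T) (insert G \<F>)" and p: "p \<in> P1" "i p = G"
    and less: "\<And>r t. r \<in> P1 \<Longrightarrow> t \<in> T \<Longrightarrow> r < t"
    and r: "r \<in> P1"
  shows "\<not> copy_below P1 \<F> (i r)"
proof
  assume "copy_below P1 \<F> (i r)"
  then obtain j where j: "embeds j P1 \<F>" and jr: "\<And>s. s \<in> P1 \<Longrightarrow> j s \<subset> i r"
    unfolding copy_below_def by blast
  define k where "k s = (if s \<in> P1 then j s else i s)" for s
  have disj: "t \<notin> P1" if "t \<in> T" for t
    using less that by blast
  have k1: "k s = j s" if "s \<in> P1" for s using that by (simp add: k_def)
  have k2: "k t = i t" if "t \<in> T" for t using that disj by (simp add: k_def)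
  \<comment> \<open>\<open>i\<close> can leave \<open>\<F>\<close> only at \<open>p\<close>, a role
    in \<open>P1\<close>, where \<open>k\<close> follows \<open>j\<close>.\<close>
  have inF: "k s \<in> \<F>" if s: "s \<in> P1 \<union> T" for s
  proof (cases "s \<in> P1")
    case False
    then have "i s \<noteq> G" using s p embeds_eq_iff[OF i, of s p] by auto
    then show ?thesis using False s embeds_in[OF i, of s] by (simp add: k_def)
  qed (simp add: k_def embeds_in[OF j])
  \<comment> \<open>The set \<open>i r\<close> lies between: it is above every \<open>j s\<close>
    and below every \<open>i t\<close>.\<close>
  have cross: "k s \<subset> k t" if "s \<in> P1" "t \<in> T" for s t
  proof -
    have "i r \<subset> i t" using that r less embeds_less_iff[OF i, of r t] by blast
    then show ?thesis using that jr by (auto simp: k1 k2)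
  qed
  have le: "s \<le> t \<longleftrightarrow> k s \<subseteq> k t" if st: "s \<in> P1 \<union> T" "t \<in> P1 \<union> T" for s t
  proof -
    consider "s \<in> P1" "t \<in> P1" | "s \<in> T" "t \<in> T" | "s \<in> P1" "t \<in> T" | "s \<in> T" "t \<in> P1"
      using st by blast
    then show ?thesis
    proof cases
      case 1 then show ?thesis by (simp add: k1 embeds_le_iff[OF j])
    next
      case 2 then show ?thesis by (simp add: k2 embeds_le_iff[OF i])
    next
      case 3 then show ?thesis using less cross by (metis order_less_imp_le psubset_imp_subset)
    next
      case 4 then show ?thesis using less cross by (metis leD psubsetE)
    qed
  qed
  have "embeds k (P1 \<union> T) \<F>"
    unfolding embeds_def using inF le by blast
  then show False using no contains_induced_copy_iff by blast
qed

text \<open>If \<open>p\<close> were in \<open>T\<close>, then \<open>i\<close> would map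
  \<open>P1\<close> to sets strictly below \<open>G\<close>, which differ from \<open>G\<close> and
  so belong to \<open>\<F>\<close>.\<close>

lemma low_role_if_not_copy_below:
  assumes i: "embeds i (P1 \<union> T) (insert G \<F>)" and p: "p \<in> P1 \<union> T" "i p = G"
    and less: "\<And>r t. r \<in> P1 \<Longrightarrow> t \<in> T \<Longrightarrow> r < t"
    and G: "\<not> copy_below P1 \<F> G"
  shows "p \<in> P1"
proof (rule ccontr)
  assume "p \<notin> P1"
  then have "p \<in> T" using p by blast
  have G_below: "i r \<subset> G" if "r \<in> P1" for r
    using that p less[OF that \<open>p \<in> T\<close>] embeds_less_iff[OF i, of r p] by blast
  then have "i r \<in> \<F>" if "r \<in> P1" for r
    using that embeds_in[OF i, of r] by blast
  then have "embeds i P1 \<F>"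
    using embeds_le_iff[OF i] unfolding embeds_def by blast
  then show False using G G_below unfolding copy_below_def by blast
qed

text \<open>A member of \<open>\<F>\<close> inside \<open>insert x A\<close> misses
  \<open>y\<close>, hence \<open>x\<close>, so it lies inside \<open>A\<close>. No set of the copy
  equals \<open>A\<close>, since its role would be greatest in \<open>P1\<close>.\<close>

lemma copy_below_insertD:
  assumes cb: "copy_below P1 \<F> (insert x A)"
    and tw: "\<And>F. F \<in> \<F> \<Longrightarrow> x \<in> F \<longleftrightarrow> y \<in> F" and xy: "x \<noteq> y"
    and A: "y \<notin> A"
    and no_greatest: "\<And>p. p \<in> P1 \<Longrightarrow> \<exists>q\<in>P1. \<not> q \<le> p"
  shows "copy_below P1 \<F> A"
proof -
  obtain j where j: "embeds j P1 \<F>" and jA: "\<And>s. s \<in> P1 \<Longrightarrow> j s \<subset> insert x A"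
    using cb unfolding copy_below_def by blast
  have sub: "j s \<subseteq> A" if "s \<in> P1" for s
    using jA[OF that] tw[OF embeds_in[OF j that]] A xy by blast
  have "j s \<noteq> A" if s: "s \<in> P1" for s
    using no_greatest[OF s] sub embeds_le_iff[OF j _ s] by blast
  with j sub show ?thesis unfolding copy_below_def by blast
qed

section \<open>Saturating families separate points\<close>

text \<open>The added set gets a role in \<open>P1\<close>, and nothing in \<open>T\<close> is below
  \<open>P1\<close>, so the cover found by the exchange has its lower element in \<open>P1\<close>.
  Hence the form of \<open>twin\<close>.\<close>

lemma saturating_imp_separating:
  assumes sat: "induced_saturating n P \<F>"
    and P: "P = P1 \<union> T" and ne: "P1 \<noteq> {}"
    and less: "\<And>r t. r \<in> P1 \<Longrightarrow> t \<in> T \<Longrightarrow> r < t"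
    and no_greatest: "\<And>p. p \<in> P1 \<Longrightarrow> \<exists>q\<in>P1. \<not> q \<le> p"
    and twin: "\<And>p q. p \<in> P1 \<Longrightarrow> covers_in P q p \<Longrightarrow> \<exists>z\<in>P. comparable z p \<noteq> comparable z q"
  shows "separating n \<F>"
proof (rule ccontr)
  assume "\<not> separating n \<F>"
  then obtain x y where x: "x \<in> {1..n}" and xy: "x \<noteq> y"
    and c: "\<And>F. F \<in> \<F> \<Longrightarrow> card (F \<inter> {x, y}) \<noteq> 1"
    unfolding separating_def by blast
  have tw: "x \<in> F \<longleftrightarrow> y \<in> F" if "F \<in> \<F>" for F
  proof (rule ccontr)
    assume "\<not> (x \<in> F \<longleftrightarrow> y \<in> F)"
    then have "F \<inter> {x, y} = {x} \<or> F \<inter> {x, y} = {y}" by auto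
    then show False using c[OF that] by auto
  qed
  have sub: "\<F> \<subseteq> Pow {1..n}" and no: "\<not> contains_induced_copy \<F> (P1 \<union> T)"
    using sat P unfolding induced_saturating_def by auto
  have fin: "finite \<F>" using sub finite_subset by blast
  have creates: "\<exists>i. embeds i (P1 \<union> T) (insert G \<F>)" if "G \<subseteq> {1..n}" "G \<notin> \<F>" for G
    using sat that P unfolding induced_saturating_def contains_induced_copy_iff by blast
  have swap: False
    if i: "embeds i (P1 \<union> T) (insert G \<F>)" and p: "p \<in> P1" "i p = G"
      and AG: "A \<in> \<F>" "A \<subset> G \<or> G \<subset> A"
      and below: "\<And>r. r \<in> P1 \<union> T \<Longrightarrow> i r \<noteq> G \<Longrightarrow> i r \<noteq> A \<Longrightarrow> i r \<subseteq> A \<longleftrightarrow> i r \<subseteq> G"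
      and above: "\<And>r. r \<in> P1 \<union> T \<Longrightarrow> i r \<noteq> G \<Longrightarrow> i r \<noteq> A \<Longrightarrow> A \<subseteq> i r \<longleftrightarrow> G \<subseteq> i r"
    for i G p A
  proof -
    have "p \<in> P1 \<union> T" using p by blast
    obtain q where cov: "covers_in P p q \<or> covers_in P q p"
      and same: "\<And>z. z \<in> P \<Longrightarrow> comparable z p \<longleftrightarrow> comparable z q"
      by (rule no_copy_imp_cover_without_twin
          [OF no i \<open>p \<in> P1 \<union> T\<close> p(2) AG below above, folded P])
        blast+
    show False
      using cov
    proof
      assume "covers_in P p q"
      moreover from this have "q \<in> P1"
        using p(1) less unfolding covers_in_def P by (metis UnE order_less_not_sym)
      ultimately show False using twin same by blast
    qed (use twin p(1) same in blast)
  qed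
  show False
  proof (cases "\<exists>A\<in>\<F>. x \<notin> A")
    case True
    \<comment> \<open>This minimal member serves to show that \<open>S\<close> is nonempty: any
      member strictly below it would avoid \<open>x\<close> too, so it is not high.\<close>
    have "\<exists>A\<in>\<F>. x \<notin> A \<and> (\<forall>B\<in>\<F>. x \<notin> B \<longrightarrow> B \<subseteq> A \<longrightarrow> A = B)"
      using finite_has_minimal[of "{A\<in>\<F>. x \<notin> A}"] True fin by auto
    then obtain A0 where A0: "A0 \<in> \<F>" "x \<notin> A0"
      and min0: "\<And>B. B \<in> \<F> \<Longrightarrow> x \<notin> B \<Longrightarrow> B \<subseteq> A0 \<Longrightarrow> A0 = B" by blast
    have "\<not> copy_below P1 \<F> A0"
      unfolding copy_below_def using ne min0 A0 embeds_in by fastforce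
    then have "\<not> copy_below P1 \<F> (insert x A0)"
      using copy_below_insertD[OF _ tw xy _ no_greatest] A0 tw by blast
    moreover define S where "S = {A\<in>\<F>. x \<notin> A \<and> \<not> copy_below P1 \<F> (insert x A)}"
    ultimately have "A0 \<in> S" "finite S" using A0 fin by simp_all
    then have "\<exists>A\<in>S. \<forall>B\<in>S. A \<subseteq> B \<longrightarrow> A = B"
      by (intro finite_has_maximal) auto
    then obtain A where A: "A \<in> \<F>" "x \<notin> A" and G: "\<not> copy_below P1 \<F> (insert x A)"
      and max: "\<And>B. B \<in> \<F> \<Longrightarrow> x \<notin> B \<Longrightarrow> \<not> copy_below P1 \<F> (insert x B) \<Longrightarrow> A \<subseteq> B \<Longrightarrow> A = B"
      unfolding S_def by (elim bexE CollectE conjE) simp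
    have yA: "y \<notin> A" using tw A by blast
    then have "insert x A \<notin> \<F>" using tw xy by blast
    moreover have "insert x A \<subseteq> {1..n}" using A sub x by auto
    ultimately obtain i where i: "embeds i (P1 \<union> T) (insert (insert x A) \<F>)"
      using creates by blast
    obtain p where "p \<in> P1 \<union> T" and p: "i p = insert x A"
      by (rule embeds_uses_new[OF i no])
    then have p1: "p \<in> P1"
      using low_role_if_not_copy_below[OF i _ _ less G] by blast
    show False
    proof (rule swap[OF i p1 p A(1)])
      show "A \<subset> insert x A \<or> insert x A \<subset> A" using A by blast
    next
      fix r assume r: "r \<in> P1 \<union> T" "i r \<noteq> insert x A" "i r \<noteq> A"
      then have rF: "i r \<in> \<F>" using embeds_in[OF i] by blast
      show "i r \<subseteq> A \<longleftrightarrow> i r \<subseteq> insert x A"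
        using tw[OF rF] xy yA by blast
      \<comment> \<open>For \<open>r\<close> in \<open>P1\<close>, if \<open>i r\<close> avoided
        \<open>x\<close>, maximality of \<open>A\<close> would make \<open>insert x (i r)\<close>
        high, hence also \<open>i r\<close>, which no low role allows. For \<open>r\<close> in
        \<open>T\<close>, \<open>i r\<close> contains the added set.\<close>
      have "x \<in> i r" if Ar: "A \<subseteq> i r"
      proof (cases "r \<in> P1")
        case True
        show ?thesis
        proof (rule ccontr)
          assume xr: "x \<notin> i r"
          then have "copy_below P1 \<F> (insert x (i r))"
            using max[OF rF] Ar r by blast
          then have "copy_below P1 \<F> (i r)"
            using copy_below_insertD[OF _ tw xy _ no_greatest] xr tw[OF rF] by blast
          then show False
            using not_copy_below_low_role[OF no i p1 p less True] by blast
        qed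
      next
        case False
        then have "p < r" using r less p1 by blast
        then show ?thesis using embeds_less_iff[OF i, of p r] p p1 r by blast
      qed
      then show "A \<subseteq> i r \<longleftrightarrow> insert x A \<subseteq> i r" by blast
    qed
  next
    case False
    \<comment> \<open>Otherwise the copy created by adding the empty set would have one element, but
      \<open>P1\<close> has at least two.\<close>
    have "\<F> \<noteq> {}"
    proof
      assume "\<F> = {}"
      then obtain i where i: "embeds i (P1 \<union> T) {{}}" using creates[of "{}"] by auto
      obtain a where a: "a \<in> P1" using ne by blast
      obtain b where b: "b \<in> P1" "\<not> b \<le> a" using no_greatest a by blast
      show False using a b embeds_in[OF i] embeds_le_iff[OF i, of b a] by auto
    qed
    then obtain A where A: "A \<in> \<F>" and min: "\<And>B. B \<in> \<F> \<Longrightarrow> B \<subseteq> A \<Longrightarrow> A = B"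
      using finite_has_minimal[of \<F>] fin by auto
    have xyA: "x \<in> A" "y \<in> A" using False A tw by blast+
    have "A - {x} \<notin> \<F>" using False by blast
    moreover have "A - {x} \<subseteq> {1..n}" using A sub by auto
    ultimately obtain i where i: "embeds i (P1 \<union> T) (insert (A - {x}) \<F>)"
      using creates by blast
    obtain p where "p \<in> P1 \<union> T" and p: "i p = A - {x}"
      by (rule embeds_uses_new[OF i no])
    moreover have "\<not> copy_below P1 \<F> (A - {x})"
      unfolding copy_below_def using ne False embeds_in by fastforce
    ultimately have p1: "p \<in> P1"
      using low_role_if_not_copy_below[OF i _ _ less] by blast
    show False
    proof (rule swap[OF i p1 p A])
      show "A \<subset> A - {x} \<or> A - {x} \<subset> A" using xyA by blast
    next
      fix r assume r: "r \<in> P1 \<union> T" "i r \<noteq> A - {x}" "i r \<noteq> A"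
      then have rF: "i r \<in> \<F>" using embeds_in[OF i] by blast
      \<comment> \<open>Both sides are false, since \<open>A\<close> is minimal in
        \<open>\<F>\<close>.\<close>
      show "i r \<subseteq> A \<longleftrightarrow> i r \<subseteq> A - {x}"
        using min[OF rF] r(3) by blast
      show "A \<subseteq> i r \<longleftrightarrow> A - {x} \<subseteq> i r"
        using False rF by blast
    qed
  qed
qed

section \<open>Splitting the poset\<close>

text \<open>Removing one greatest element \<open>m\<close> suffices: a greatest element of the rest
  would be covered by \<open>m\<close>, and all of \<open>P0\<close> would be comparable to
  both.\<close>

lemma uctp_with_top_chain_decomposition:
  assumes "uctp_with_top_chain P"
  obtains P1 T where "P = P1 \<union> T" "P1 \<noteq> {}"
    "\<And>r t. r \<in> P1 \<Longrightarrow> t \<in> T \<Longrightarrow> r < t"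
    "\<And>p. p \<in> P1 \<Longrightarrow> \<exists>q\<in>P1. \<not> q \<le> p"
    "\<And>p q. p \<in> P1 \<Longrightarrow> covers_in P q p \<Longrightarrow> \<exists>z\<in>P. comparable z p \<noteq> comparable z q"
proof -
  obtain P0 C a b where P: "P = P0 \<union> C" and ab: "a \<in> P0" "b \<in> P0" "a \<noteq> b"
    and u: "uctp P0" and less: "\<And>p c. p \<in> P0 \<Longrightarrow> c \<in> C \<Longrightarrow> p < c"
    using assms unfolding uctp_with_top_chain_def by (elim exE conjE bexE) simp
  have twin0: "\<exists>z\<in>P0. comparable z p \<noteq> comparable z q" if "covers_in P0 q p" for p q
    using u that unfolding uctp_def by blast
  have twin: "\<exists>z\<in>P. comparable z p \<noteq> comparable z q"
    if "p \<in> P0" "q \<in> P0" "covers_in P q p" for p q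
  proof -
    have "covers_in P0 q p" using that unfolding P covers_in_def by blast
    from twin0[OF this] show ?thesis unfolding P by blast
  qed
  show thesis
  proof (cases "\<exists>m\<in>P0. \<forall>q\<in>P0. q \<le> m")
    case True
    then obtain m where m: "m \<in> P0" "\<And>q. q \<in> P0 \<Longrightarrow> q \<le> m" by blast
    have ltm: "r < m" if "r \<in> P0 - {m}" for r
      using that m by (simp add: order_less_le)
    show thesis
    proof (rule that[of "P0 - {m}" "insert m C"])
      show "P = P0 - {m} \<union> insert m C" using P m by blast
      show "P0 - {m} \<noteq> {}" using ab by blast
      show "r < t" if "r \<in> P0 - {m}" "t \<in> insert m C" for r t
        using that less ltm by blast
    next
      fix p assume p: "p \<in> P0 - {m}"
      show "\<exists>q\<in>P0 - {m}. \<not> q \<le> p"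
      proof (rule ccontr)
        assume "\<not> ?thesis"
        then have g: "\<And>q. q \<in> P0 - {m} \<Longrightarrow> q \<le> p" by blast
        have "covers_in P0 m p"
          unfolding covers_in_def using p m ltm[OF p] g
          by (metis DiffI leD order_less_irrefl singletonD DiffD1)
        from twin0[OF this] obtain z where z: "z \<in> P0" "comparable z p \<noteq> comparable z m" by blast
        then show False using g[of z] m ltm[OF p] unfolding comparable_def
          by (cases "z = m") auto
      qed
    next
      fix p q assume p: "p \<in> P0 - {m}" and cov: "covers_in P q p"
      \<comment> \<open>Otherwise \<open>m\<close> would lie strictly between \<open>p\<close> and
        \<open>q\<close>.\<close>
      have "q \<in> P0"
      proof (rule ccontr)
        assume "q \<notin> P0"
        then have "m < q" using cov less m unfolding covers_in_def P by blast
        then show False using cov ltm[OF p] m unfolding covers_in_def P by blast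
      qed
      then show "\<exists>z\<in>P. comparable z p \<noteq> comparable z q" using twin p cov by blast
    qed
  next
    case False
    then have no_greatest: "\<And>p. p \<in> P0 \<Longrightarrow> \<exists>q\<in>P0. \<not> q \<le> p" by blast
    show thesis
    proof (rule that[OF P _ less no_greatest])
      show "P0 \<noteq> {}" using ab by blast
    next
      fix p q assume p: "p \<in> P0" and cov: "covers_in P q p"
      show "\<exists>z\<in>P. comparable z p \<noteq> comparable z q"
      proof (cases "q \<in> P0")
        case True then show ?thesis using twin p cov by blast
      next
        case False
        then have qC: "q \<in> C" using cov unfolding covers_in_def P by blast
        \<comment> \<open>This \<open>z\<close> is the twin witness: it is below \<open>q\<close>,
          and it cannot be above \<open>p\<close>, or it would lie strictly between \<open>p\<close>
          and \<open>q\<close>.\<close>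
        obtain z where z: "z \<in> P0" "\<not> z \<le> p" using no_greatest p by blast
        have "z < q" using less z qC by blast
        then have "\<not> p \<le> z"
          using cov z unfolding covers_in_def P by (auto simp: order_le_less)
        then show ?thesis
          using z \<open>z < q\<close> unfolding comparable_def P by (auto intro: order_less_imp_le)
      qed
    qed
  qed
qed

section \<open>The logarithmic bound\<close>

text \<open>This ensures that the \<open>LEAST\<close> in \<open>sat_star\<close> is
  attained.\<close>

lemma saturating_exists:
  assumes "P \<noteq> {}"
  shows "\<exists>\<F>. induced_saturating n P \<F>"
proof -
  let ?S = "{\<F>. \<F> \<subseteq> Pow {1..n} \<and> \<not> contains_induced_copy \<F> P}"
  have "{} \<in> ?S" using assms by (auto simp: contains_induced_copy_iff embeds_def)
  moreover have "finite ?S" by (rule finite_subset[of _ "Pow (Pow {1..n})"]) auto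
  ultimately have "\<exists>\<F>\<in>?S. \<forall>\<G>\<in>?S. \<F> \<subseteq> \<G> \<longrightarrow> \<F> = \<G>"
    by (intro finite_has_maximal) auto
  then obtain \<F> where F: "\<F> \<subseteq> Pow {1..n}" "\<not> contains_induced_copy \<F> P"
    and max: "\<forall>\<G>\<in>?S. \<F> \<subseteq> \<G> \<longrightarrow> \<F> = \<G>"
    by (elim bexE CollectE conjE)
  have "contains_induced_copy (insert G \<F>) P" if G: "G \<in> Pow {1..n} - \<F>" for G
  proof (rule ccontr)
    assume "\<not> ?thesis"
    then have "insert G \<F> \<in> ?S" using F G by simp
    then have "\<F> = insert G \<F>" using max by (meson subset_insertI)
    then show False using G by blast
  qed
  with F have "induced_saturating n P \<F>" unfolding induced_saturating_def by simp
  then show ?thesis ..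
qed

text \<open>Distinct points lie in distinct subfamilies of \<open>\<F>\<close>.\<close>

lemma separating_imp_card_bound:
  assumes "separating n \<F>" "finite \<F>"
  shows "n \<le> 2 ^ card \<F>"
proof -
  have "inj_on (\<lambda>x. {F\<in>\<F>. x \<in> F}) {1..n}"
  proof (rule inj_onI, rule ccontr)
    fix x y assume "x \<in> {1..n}" "y \<in> {1..n}" "x \<noteq> y"
      and eq: "{F\<in>\<F>. x \<in> F} = {F\<in>\<F>. y \<in> F}"
    then obtain F where F: "F \<in> \<F>" "card (F \<inter> {x, y}) = 1"
      using assms(1) unfolding separating_def by blast
    have "x \<in> F \<longleftrightarrow> y \<in> F" using eq F by blast
    then have "F \<inter> {x, y} = {} \<or> F \<inter> {x, y} = {x, y}" by auto
    then show False using F \<open>x \<noteq> y\<close> by auto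
  qed
  then have "card {1..n} \<le> card (Pow \<F>)"
    by (rule card_inj_on_le) (use assms in auto)
  then show ?thesis using assms by (simp add: card_Pow)
qed

theorem theorem16:
  fixes P :: "'a::order set"
  assumes "uctp_with_top_chain P"
  shows "(\<forall>n \<F>. induced_saturating n P \<F> \<longrightarrow> separating n \<F>) \<and>
         (\<forall>n\<ge>1. real (sat_star n P) \<ge> log 2 (real n))"
proof -
  obtain P1 T where dec: "P = P1 \<union> T" "P1 \<noteq> {}"
    "\<And>r t. r \<in> P1 \<Longrightarrow> t \<in> T \<Longrightarrow> r < t"
    "\<And>p. p \<in> P1 \<Longrightarrow> \<exists>q\<in>P1. \<not> q \<le> p"
    "\<And>p q. p \<in> P1 \<Longrightarrow> covers_in P q p \<Longrightarrow> \<exists>z\<in>P. comparable z p \<noteq> comparable z q"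
    by (rule uctp_with_top_chain_decomposition[OF assms]) (rule that, assumption+)
  have sep: "separating n \<F>" if "induced_saturating n P \<F>" for n \<F>
    by (rule saturating_imp_separating[OF that dec])
  have "log 2 (real n) \<le> real (sat_star n P)" if "n \<ge> 1" for n
  proof -
    have "P \<noteq> {}" using dec by blast
    then have "\<exists>m \<F>. induced_saturating n P \<F> \<and> card \<F> = m" using saturating_exists by blast
    then have "\<exists>\<F>. induced_saturating n P \<F> \<and> card \<F> = sat_star n P"
      unfolding sat_star_def by (rule LeastI_ex)
    then obtain \<F> where F: "induced_saturating n P \<F>" and card: "card \<F> = sat_star n P"
      by blast
    have "finite \<F>" using F finite_subset unfolding induced_saturating_def by blast
    from separating_imp_card_bound[OF sep[OF F] this]
    have "real n \<le> 2 ^ sat_star n P"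
      unfolding card by (metis of_nat_le_iff of_nat_numeral of_nat_power)
    then show ?thesis using that by (subst log_le_iff) (auto simp: powr_realpow)
  qed
  with sep show ?thesis by blast
qed

end
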